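(* Let $\Theta\subset\mathbb{R}^d$ be compact, let $\{\nu_\theta\}_{\theta\in\Theta}$ be a family of probability distributions on $(0,1)$, and let $\theta^\star$ be an interior point of $\Theta$. Assume that for every $\theta\in\Theta$, $\mathbb{E}^\theta|\log\rho_0|<\infty$ and $\mathbb{E}^\theta(\log\rho_0)<0$. If $$\mathbb{E}^{\theta^\star}(\rho_0)<1,$$ then $\ell(\theta)=\mathbf{E}^\star[\phi_\theta(\tilde Z_0,\tilde Z_1)]$ is finite for every $\theta\in\Theta$.
   Context: $\mathbb{N}=\{0,1,2,\dots\}$. For $\theta\in\Theta$, $\mathbb{P}^\theta=\nu_\theta^{\otimes\mathbb{Z}}$ is the law on $(0,1)^{\mathbb{Z}}$ of an i.i.d. environment $\omega=\{\omega_x\}_{x\in\mathbb{Z}}$ with marginal $\nu_\theta$, with expectation $\mathbb{E}^\theta$, and $\rho_x=(1-\omega_x)/\omega_x$. For $x,y\in\mathbb{N}$, $$\phi_\theta(x,y)=\log\int_0^1 a^{x+1}(1-a)^y\,d\nu_\theta(a),\qquad Q_\theta(x,y)=\binom{x+y}{x}e^{\phi_\theta(x,y)}.$$ $Q_\theta$ is a Markov transition kernel on $\mathbb{N}$. Under the integrability and negativity assumption on $\log\rho_0$, $Q_{\theta^\star}$ has a unique invariant probability measure $\pi^\star$, given by $\pi^\star(k)=\mathbb{E}^{\theta^\star}[S(1-S)^k]$ with $S=(1+\rho_1+\rho_1\rho_2+\rho_1\rho_2\rho_3+\cdots)^{-1}$. $\{\tilde Z_n\}_{n\in\mathbb{N}}$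 denotes the stationary Markov chain with transition kernel $Q_{\theta^\star}$ and initial distribution $\pi^\star$, and $\mathbf{E}^\star$ the corresponding expectation; a priori $\ell(\theta)\in[-\infty,0]$. *)

theory Defs
  imports "HOL-Probability.Probability"
begin

definition env :: "('p \<Rightarrow> real measure) \<Rightarrow> 'p \<Rightarrow> (int \<Rightarrow> real) measure" where
  "env \<nu> \<theta> = PiM UNIV (\<lambda>_. \<nu> \<theta>)"

definition rho :: "(int \<Rightarrow> real) \<Rightarrow> int \<Rightarrow> real" where
  "rho \<omega> x = (1 - \<omega> x) / \<omega> x"

definition phi :: "('p \<Rightarrow> real measure) \<Rightarrow> 'p \<Rightarrow> nat \<Rightarrow> nat \<Rightarrow> real" where
  "phi \<nu> \<theta> x y = ln (\<integral>a. a ^ (x + 1) * (1 - a) ^ y \<partial>\<nu> \<theta>)"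

definition Q :: "('p \<Rightarrow> real measure) \<Rightarrow> 'p \<Rightarrow> nat \<Rightarrow> nat \<Rightarrow> real" where
  "Q \<nu> \<theta> x y = real ((x + y) choose x) * exp (phi \<nu> \<theta> x y)"

text \<open>The series is summed in the extended nonnegative reals, so that \<open>S \<omega> = 0\<close> where it
  diverges. The term with index 0 is the empty product, i.e. the leading 1.\<close>

definition S :: "(int \<Rightarrow> real) \<Rightarrow> real" where
  "S \<omega> = enn2real (inverse (\<Sum>n. ennreal (\<Prod>j=1..n. rho \<omega> (int j))))"

text \<open>When \<open>ln (rho \<omega> 0)\<close> is integrable with negative mean, this is the unique invariant
  probability of the kernel \<open>Q \<nu> \<theta>\<close>.\<close>

definition inv_prob :: "('p \<Rightarrow> real measure) \<Rightarrow> 'p \<Rightarrow> nat \<Rightarrow> real" where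
  "inv_prob \<nu> \<theta> k = (\<integral>\<omega>. S \<omega> * (1 - S \<omega>) ^ k \<partial>env \<nu> \<theta>)"

definition markov_chain ::
  "'a measure \<Rightarrow> (nat \<Rightarrow> real) \<Rightarrow> (nat \<Rightarrow> nat \<Rightarrow> real) \<Rightarrow> (nat \<Rightarrow> 'a \<Rightarrow> nat) \<Rightarrow> bool" where
  "markov_chain M \<mu> K Z \<longleftrightarrow>
     prob_space M \<and>
     (\<forall>n. Z n \<in> measurable M (count_space UNIV)) \<and>
     (\<forall>k. \<P>(w in M. Z 0 w = k) = \<mu> k) \<and>
     (\<forall>n x y. \<P>(w in M. \<forall>i\<le>n. Z i w = x i) > 0 \<longrightarrow>
        \<P>(w in M. Z (Suc n) w = y \<bar> \<forall>i\<le>n. Z i w = x i) = K (x n) y)"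

text \<open>Since \<open>\<infinity> - \<infinity> = \<infinity>\<close> in \<^typ>\<open>ereal\<close>, for measurable \<open>f\<close> this is finite iff \<open>f\<close> is
  integrable.\<close>

definition ext_expectation :: "'a measure \<Rightarrow> ('a \<Rightarrow> real) \<Rightarrow> ereal" where
  "ext_expectation M f =
     enn2ereal (\<integral>\<^sup>+w. ennreal (f w) \<partial>M) - enn2ereal (\<integral>\<^sup>+w. ennreal (- f w) \<partial>M)"

definition ell ::
  "('p \<Rightarrow> real measure) \<Rightarrow> 'a measure \<Rightarrow> (nat \<Rightarrow> 'a \<Rightarrow> nat) \<Rightarrow> 'p \<Rightarrow> ereal" where
  "ell \<nu> M Z \<theta> = ext_expectation M (\<lambda>w. phi \<nu> \<theta> (Z 0 w) (Z 1 w))"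

end

theory Submission
  imports Defs
begin

text \<open>
  The statement reduces to finiteness of two first moments. For \<open>a \<in> (0,1)\<close> both \<open>a\<close> and \<open>1 - a\<close>
  dominate \<open>a (1 - a)\<close>, so Jensen's inequality for the convex function \<open>t \<mapsto> t ^ (x + 1 + y)\<close> bounds
  the integral defining \<open>phi\<close> from below by \<open>c ^ (x + 1 + y)\<close>, where
  \<open>c = \<integral> a (1 - a) d\<nu>\<^sub>\<theta> > 0\<close>; the integral is at most 1 as well. Hence
  \<open>0 \<le> - \<phi>\<^sub>\<theta>(x, y) \<le> (x + 1 + y) ln (1 / c)\<close>, with a constant depending on \<open>\<theta>\<close>, and it suffices that
  \<open>Z\<^sub>0\<close> and \<open>Z\<^sub>1\<close> have finite mean under the law of the chain, which only involves \<open>\<theta>\<^sup>\<star>\<close>.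
  This is where \<open>r = E \<rho>\<^sub>0 < 1\<close> enters.

  The law of \<open>Z\<^sub>0\<close> is the mixture, over the environment, of geometric laws with success probability
  \<open>S\<close>, whose means are \<open>(1 - S) / S \<le> 1 / S = \<Sum>\<^sub>n \<rho>\<^sub>1 \<cdots> \<rho>\<^sub>n\<close>; where the series diverges, the bound
  by its value is trivial.
  By independence the expectation of the series is \<open>\<Sum>\<^sub>n r ^ n < \<infinity>\<close>; this is \<open>inv_prob_mean_le\<close>.

  The row \<open>Q(x, \<cdot>)\<close> is a mixture over \<open>a \<sim> \<nu>\<close> of negative binomial laws with \<open>x + 1\<close> successes of
  probability \<open>a\<close>, whose mean is \<open>(x + 1) (1 - a) / a\<close>. So \<open>E[Z\<^sub>1 | Z\<^sub>0 = x] = (x + 1) r\<close>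
  (\<open>transition_mean\<close>), and \<open>E Z\<^sub>1 = (E Z\<^sub>0 + 1) r\<close> is finite.
\<close>

section \<open>Geometric and negative binomial series\<close>

text \<open>The negative binomial mean in the parametrisation of the rows of \<open>Q\<close>; \<open>x = 0\<close> is the
  geometric law.\<close>

lemma neg_binomial_mean_series:
  fixes p :: real
  assumes "0 < p" "p \<le> 1"
  shows "(\<Sum>k. of_nat k * ennreal (real ((x + k) choose x) * (p ^ (x + 1) * (1 - p) ^ k))) =
    of_nat (x + 1) * ennreal ((1 - p) / p)"
proof -
  have p: "p \<in> {0<..1}" using assms by auto
  have pmf: "pmf (neg_binomial_pmf (x + 1) p) k =
      real ((x + k) choose x) * (p ^ (x + 1) * (1 - p) ^ k)" for k
    using binomial_symmetric[of x "x + k"] by (simp add: pmf_neg_binomial[OF p] add.commute)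
  have "(\<Sum>k. of_nat k * ennreal (real ((x + k) choose x) * (p ^ (x + 1) * (1 - p) ^ k))) =
      (\<Sum>k. ennreal (pmf (neg_binomial_pmf (x + 1) p) k) * of_nat k)"
    unfolding pmf by (simp add: mult_ac)
  also have "\<dots> = nn_integral (measure_pmf (neg_binomial_pmf (x + 1) p)) of_nat"
    by (simp add: nn_integral_measure_pmf nn_integral_count_space_nat)
  also have "\<dots> = of_nat (x + 1) * ennreal ((1 - p) / p)"
    using assms unfolding nn_integral_neg_binomial_pmf_real[OF p]
    by (simp only: times_divide_eq_right[symmetric] ennreal_of_nat_eq_real_of_nat)
       (rule ennreal_mult, auto)
  finally show ?thesis .
qed

text \<open>For finite \<open>D\<close>, a geometric variable with success probability \<open>1 / D\<close> has mean \<open>D - 1\<close>. The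
  case \<open>D = \<infinity>\<close> covers the environments where the series defining \<open>S\<close> diverges.\<close>

lemma geometric_mean_le_inverse:
  fixes D :: ennreal
  assumes "1 \<le> D"
  defines "s \<equiv> enn2real (inverse D)"
  shows "(\<Sum>k. of_nat k * ennreal (s * (1 - s) ^ k)) \<le> D"
proof (cases D)
  case (real d)
  then have d: "1 \<le> d" using assms(1) by simp
  then have s: "s = 1 / d" using real by (simp add: s_def inverse_ennreal inverse_eq_divide)
  have "(\<Sum>k. of_nat k * ennreal (s * (1 - s) ^ k)) = ennreal ((1 - s) / s)"
    using neg_binomial_mean_series[of s 0] d by (simp add: s)
  also have "\<dots> \<le> ennreal d"
    using d by (intro ennreal_leI) (simp add: s field_simps)
  finally show ?thesis using real by simp
qed simp

lemma geometric_suminf_ennreal_less_top: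
  fixes r :: ennreal
  assumes "r < 1"
  shows "(\<Sum>n. r ^ n) < \<top>"
proof (cases r)
  case (real q)
  then have "0 \<le> q" "q < 1" using assms by simp_all
  then have "(\<lambda>n. q ^ n) sums (1 / (1 - q))" by (simp add: geometric_sums)
  then have "(\<Sum>n. r ^ n) = ennreal (1 / (1 - q))"
    using \<open>0 \<le> q\<close> real by (simp add: ennreal_power suminf_ennreal2 sums_iff)
  then show ?thesis by simp
qed (use assms in simp)

section \<open>Moments of a law on the unit interval\<close>

lemma space_unit_interval_measure:
  assumes "sets m = sets (restrict_space borel {0<..<1::real})"
  shows "space m = {0<..<1}"
  using sets_eq_imp_space_eq[OF assms] by (simp add: space_restrict_space)

lemma borel_measurable_unit_interval:
  assumes "sets m = sets (restrict_space borel {0<..<1::real})" "f \<in> borel_measurable borel"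
  shows "f \<in> borel_measurable m"
  using measurable_restrict_space1[OF assms(2)] by (simp add: measurable_cong_sets[OF assms(1) refl])

text \<open>The lower bound is exponential in \<open>x + 1 + y\<close>, which makes \<open>- phi\<close> grow at most linearly. It
  combines \<open>a (1 - a) \<le> min a (1 - a)\<close> with Jensen's inequality.\<close>

lemma kernel_integral_bounds:
  fixes m :: "real measure"
  assumes "prob_space m" and m: "sets m = sets (restrict_space borel {0<..<1})"
  defines "c \<equiv> (\<integral>a. a * (1 - a) \<partial>m)"
  shows "integrable m (\<lambda>a. a ^ (x + 1) * (1 - a) ^ y)"
    and "0 < c"
    and "c ^ (x + 1 + y) \<le> (\<integral>a. a ^ (x + 1) * (1 - a) ^ y \<partial>m)"
    and "(\<integral>a. a ^ (x + 1) * (1 - a) ^ y \<partial>m) \<le> 1"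
proof -
  interpret prob_space m by fact
  note space = space_unit_interval_measure[OF m]
  note [measurable] = borel_measurable_unit_interval[OF m]
  have bound: "0 \<le> a ^ i * (1 - a) ^ j" "a ^ i * (1 - a) ^ j \<le> 1" if "a \<in> {0<..<1}" for a :: real and i j
    using that by (auto intro!: mult_le_one power_le_one)
  have int: "integrable m (\<lambda>a. a ^ i * (1 - a) ^ j)" for i j
    by (rule integrable_const_bound[where B = 1])
      (use bound space in auto)
  show "integrable m (\<lambda>a. a ^ (x + 1) * (1 - a) ^ y)" by (rule int)
  show "(\<integral>a. a ^ (x + 1) * (1 - a) ^ y \<partial>m) \<le> 1"
    by (rule integral_le_const[OF int]) (use bound space in \<open>auto simp del: power_Suc\<close>)
  have int1: "integrable m (\<lambda>a. a * (1 - a))" using int[of 1 1] by simp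
  show "0 < c"
    unfolding c_def by (rule expectation_greater[OF int1]) (auto simp: space)
  let ?n = "x + 1 + y"
  have "c ^ ?n \<le> (\<integral>a. (a * (1 - a)) ^ ?n \<partial>m)"
    unfolding c_def
  proof (rule jensens_inequality[where I = "{0<..}" and q = "\<lambda>t. t ^ ?n"])
    show "convex_on {0<..} (\<lambda>t::real. t ^ ?n)"
      using convex_power_even[of ?n] convex_power_odd[of ?n]
      by (cases "even ?n") (auto intro: convex_on_subset)
    show "integrable m (\<lambda>a. (a * (1 - a)) ^ ?n)"
      unfolding power_mult_distrib by (rule int)
  qed (use int1 space in auto)
  also have "\<dots> \<le> (\<integral>a. a ^ (x + 1) * (1 - a) ^ y \<partial>m)"
  proof (rule integral_mono)
    fix a assume "a \<in> space m"
    then have a: "0 < a" "a < 1" by (auto simp: space)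
    show "(a * (1 - a)) ^ ?n \<le> a ^ (x + 1) * (1 - a) ^ y"
      unfolding power_mult_distrib
      by (intro mult_mono power_decreasing) (use a in auto)
  qed (simp_all only: power_mult_distrib int)
  finally show "c ^ ?n \<le> (\<integral>a. a ^ (x + 1) * (1 - a) ^ y \<partial>m)" .
qed

locale unit_interval_law = prob_space "\<nu> \<theta>"
  for \<nu> :: "'p \<Rightarrow> real measure" and \<theta> :: 'p +
  assumes sets_law: "sets (\<nu> \<theta>) = sets (restrict_space borel {0<..<1})"
begin

lemmas space_law = space_unit_interval_measure[OF sets_law]
  and measurable_law = borel_measurable_unit_interval[OF sets_law]
  and integral_bounds = kernel_integral_bounds[OF prob_space_axioms sets_law]

lemma phi_bounds:
  shows "exp (phi \<nu> \<theta> x y) = (\<integral>a. a ^ (x + 1) * (1 - a) ^ y \<partial>\<nu> \<theta>)"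
    and "phi \<nu> \<theta> x y \<le> 0"
    and "- phi \<nu> \<theta> x y \<le> - ln (\<integral>a. a * (1 - a) \<partial>\<nu> \<theta>) * real (x + 1 + y)"
proof -
  have pos: "0 < (\<integral>a. a ^ (x + 1) * (1 - a) ^ y \<partial>\<nu> \<theta>)"
    using integral_bounds(3)[of x y] zero_less_power[OF integral_bounds(2), of "x + 1 + y"] by linarith
  then show "exp (phi \<nu> \<theta> x y) = (\<integral>a. a ^ (x + 1) * (1 - a) ^ y \<partial>\<nu> \<theta>)"
    by (simp add: phi_def)
  show "phi \<nu> \<theta> x y \<le> 0"
    unfolding phi_def using pos integral_bounds(4)[of x y] by (subst ln_le_zero_iff) auto
  have "ln ((\<integral>a. a * (1 - a) \<partial>\<nu> \<theta>) ^ (x + 1 + y)) \<le> phi \<nu> \<theta> x y"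
    unfolding phi_def using integral_bounds(3)[of x y] zero_less_power[OF integral_bounds(2)]
    by (intro ln_mono) (auto simp del: power_Suc)
  then show "- phi \<nu> \<theta> x y \<le> - ln (\<integral>a. a * (1 - a) \<partial>\<nu> \<theta>) * real (x + 1 + y)"
    using integral_bounds(2) by (simp add: ln_realpow mult.commute del: power_Suc of_nat_add of_nat_Suc)
qed

text \<open>Mean of one step of the chain: integrate the negative binomial mean over its random success
  probability.\<close>

lemma transition_mean:
  shows "(\<Sum>y. of_nat y * ennreal (Q \<nu> \<theta> x y)) =
    of_nat (x + 1) * (\<integral>\<^sup>+a. ennreal ((1 - a) / a) \<partial>\<nu> \<theta>)"
proof -
  note [measurable] = measurable_law
  have Q: "ennreal (Q \<nu> \<theta> x y) =
      (\<integral>\<^sup>+a. ennreal (real ((x + y) choose x) * (a ^ (x + 1) * (1 - a) ^ y)) \<partial>\<nu> \<theta>)" for y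
    unfolding Q_def phi_bounds(1)
    by (subst nn_integral_eq_integral)
      (use integral_bounds(1)[of x y] in \<open>auto simp: space_law simp del: power_Suc\<close>)
  have "(\<Sum>y. of_nat y * ennreal (Q \<nu> \<theta> x y)) =
      (\<integral>\<^sup>+a. (\<Sum>y. of_nat y *
        ennreal (real ((x + y) choose x) * (a ^ (x + 1) * (1 - a) ^ y))) \<partial>\<nu> \<theta>)"
    unfolding Q by (simp add: nn_integral_cmult nn_integral_suminf)
  also have "\<dots> = (\<integral>\<^sup>+a. of_nat (x + 1) * ennreal ((1 - a) / a) \<partial>\<nu> \<theta>)"
    by (intro nn_integral_cong neg_binomial_mean_series) (auto simp: space_law)
  also have "\<dots> = of_nat (x + 1) * (\<integral>\<^sup>+a. ennreal ((1 - a) / a) \<partial>\<nu> \<theta>)"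
    by (rule nn_integral_cmult) measurable
  finally show ?thesis .
qed

section \<open>Moments over the environment\<close>

lemma nn_integral_env_prod:
  assumes "finite J" and [measurable]: "f \<in> borel_measurable (\<nu> \<theta>)"
  shows "(\<integral>\<^sup>+\<omega>. (\<Prod>j\<in>J. f (\<omega> j)) \<partial>env \<nu> \<theta>) = (\<integral>\<^sup>+a. f a \<partial>\<nu> \<theta>) ^ card J"
proof -
  interpret product_prob_space "\<lambda>_::int. \<nu> \<theta>" UNIV
    using prob_space_axioms by (simp add: product_prob_space_def product_prob_space_axioms_def
        product_sigma_finite_def prob_space_imp_sigma_finite)
  have "(\<integral>\<^sup>+\<omega>. (\<Prod>j\<in>J. f (\<omega> j)) \<partial>env \<nu> \<theta>) =
      (\<integral>\<^sup>+\<omega>. (\<Prod>j\<in>J. f (\<omega> j)) \<partial>distr (env \<nu> \<theta>) (PiM J (\<lambda>_. \<nu> \<theta>)) (\<lambda>\<omega>. restrict \<omega> J))"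
    unfolding env_def by (subst nn_integral_distr) (auto simp: measurable_restrict_subset)
  also have "\<dots> = (\<integral>\<^sup>+\<omega>. (\<Prod>j\<in>J. f (\<omega> j)) \<partial>PiM J (\<lambda>_. \<nu> \<theta>))"
    unfolding env_def by (subst distr_PiM_restrict_finite) (use \<open>finite J\<close> in auto)
  also have "\<dots> = (\<integral>\<^sup>+a. f a \<partial>\<nu> \<theta>) ^ card J"
    by (subst product_nn_integral_prod) (use \<open>finite J\<close> in auto)
  finally show ?thesis .
qed

lemma nn_integral_rho:
  shows "(\<integral>\<^sup>+\<omega>. ennreal (rho \<omega> 0) \<partial>env \<nu> \<theta>) = (\<integral>\<^sup>+a. ennreal ((1 - a) / a) \<partial>\<nu> \<theta>)"
proof -
  have "(\<lambda>a. ennreal ((1 - a) / a)) \<in> borel_measurable (\<nu> \<theta>)"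
    by (rule measurable_law) simp
  from nn_integral_env_prod[OF _ this, of "{0}"] show ?thesis
    by (simp add: rho_def)
qed

lemma nn_integral_prod_rho:
  shows "(\<integral>\<^sup>+\<omega>. ennreal (\<Prod>j=1..n. rho \<omega> (int j)) \<partial>env \<nu> \<theta>) =
    (\<integral>\<^sup>+\<omega>. ennreal (rho \<omega> 0) \<partial>env \<nu> \<theta>) ^ n"
proof -
  have pos: "0 < \<omega> i \<and> \<omega> i < 1" if "\<omega> \<in> space (env \<nu> \<theta>)" for \<omega> i
    using that space_law by (auto simp: env_def space_PiM PiE_iff)
  have "(\<integral>\<^sup>+\<omega>. ennreal (\<Prod>j=1..n. rho \<omega> (int j)) \<partial>env \<nu> \<theta>) =
      (\<integral>\<^sup>+\<omega>. (\<Prod>j\<in>int ` {1..n}. ennreal ((1 - \<omega> j) / \<omega> j)) \<partial>env \<nu> \<theta>)"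
  proof (rule nn_integral_cong)
    fix \<omega> assume "\<omega> \<in> space (env \<nu> \<theta>)"
    then have "0 \<le> rho \<omega> i" for i
      using pos[of \<omega> i] by (simp add: rho_def)
    then show "ennreal (\<Prod>j=1..n. rho \<omega> (int j)) =
        (\<Prod>j\<in>int ` {1..n}. ennreal ((1 - \<omega> j) / \<omega> j))"
      by (simp add: prod.reindex prod_ennreal[symmetric] rho_def)
  qed
  also have "\<dots> = (\<integral>\<^sup>+a. ennreal ((1 - a) / a) \<partial>\<nu> \<theta>) ^ n"
    by (subst nn_integral_env_prod)
      (simp_all add: card_image measurable_law)
  finally show ?thesis
    by (simp add: nn_integral_rho)
qed

text \<open>Exchanging sum and expectation, the mean of the geometric law attached to an
  environment is at most the series of which \<open>S\<close> is the reciprocal; its \<open>n\<close>-th term has expectation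
  \<open>r ^ n\<close>, where \<open>r = E \<rho>\<^sub>0\<close>.\<close>

lemma inv_prob_mean_le:
  shows "(\<Sum>k. of_nat k * ennreal (inv_prob \<nu> \<theta> k)) \<le>
    (\<Sum>n. (\<integral>\<^sup>+\<omega>. ennreal (rho \<omega> 0) \<partial>env \<nu> \<theta>) ^ n)"
proof -
  define D where "D \<omega> = (\<Sum>n. ennreal (\<Prod>j=1..n. rho \<omega> (int j)))" for \<omega>
  have [measurable]: "(\<lambda>\<omega>. \<omega> i) \<in> borel_measurable (env \<nu> \<theta>)" for i
  proof -
    have "(\<lambda>\<omega>. \<omega> i) \<in> measurable (env \<nu> \<theta>) (\<nu> \<theta>)"
      by (simp add: env_def)
    then show ?thesis
      by (rule measurable_compose) (rule measurable_law, simp)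
  qed
  have [measurable]: "(\<lambda>\<omega>. rho \<omega> i) \<in> borel_measurable (env \<nu> \<theta>)" for i
    unfolding rho_def by measurable
  have S_D: "S \<omega> = enn2real (inverse (D \<omega>))" for \<omega>
    by (simp add: S_def D_def)
  have [measurable]: "S \<in> borel_measurable (env \<nu> \<theta>)"
    unfolding S_def by measurable
  have D_ge: "1 \<le> D \<omega>" for \<omega>
    unfolding D_def using sum_le_suminf[of "\<lambda>n. ennreal (\<Prod>j=1..n. rho \<omega> (int j))" "{0}"] by simp
  have S01: "0 \<le> S \<omega>" "S \<omega> \<le> 1" for \<omega>
    using D_ge[of \<omega>] unfolding S_D
    by (cases "D \<omega>"; auto simp: inverse_ennreal inverse_le_1_iff)+
  have "ennreal (inv_prob \<nu> \<theta> k) \<le> (\<integral>\<^sup>+\<omega>. ennreal (S \<omega> * (1 - S \<omega>) ^ k) \<partial>env \<nu> \<theta>)" for k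
    unfolding inv_prob_def using S01
    by (subst integral_eq_nn_integral) (auto simp: ennreal_enn2real_if)
  then have "(\<Sum>k. of_nat k * ennreal (inv_prob \<nu> \<theta> k)) \<le>
      (\<Sum>k. of_nat k * (\<integral>\<^sup>+\<omega>. ennreal (S \<omega> * (1 - S \<omega>) ^ k) \<partial>env \<nu> \<theta>))"
    by (intro suminf_le mult_left_mono) auto
  also have "\<dots> = (\<integral>\<^sup>+\<omega>. (\<Sum>k. of_nat k * ennreal (S \<omega> * (1 - S \<omega>) ^ k)) \<partial>env \<nu> \<theta>)"
    by (simp add: nn_integral_cmult nn_integral_suminf)
  also have "\<dots> \<le> (\<integral>\<^sup>+\<omega>. D \<omega> \<partial>env \<nu> \<theta>)"
    unfolding S_D by (intro nn_integral_mono geometric_mean_le_inverse D_ge)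
  also have "\<dots> = (\<Sum>n. (\<integral>\<^sup>+\<omega>. ennreal (rho \<omega> 0) \<partial>env \<nu> \<theta>) ^ n)"
    unfolding D_def
    by (subst nn_integral_suminf) (measurable, simp only: nn_integral_prod_rho)
  finally show ?thesis .
qed

end

section \<open>The first two states of a Markov chain\<close>

lemma nn_integral_countable_valued:
  fixes X :: "'a \<Rightarrow> 'b::countable"
  assumes [measurable]: "X \<in> measurable M (count_space UNIV)"
  shows "(\<integral>\<^sup>+w. f (X w) \<partial>M) =
    (\<integral>\<^sup>+k. f k * emeasure M {w \<in> space M. X w = k} \<partial>count_space UNIV)"
proof -
  have eq: "distr M (count_space UNIV) X =
      density (count_space UNIV) (\<lambda>k. emeasure M {w \<in> space M. X w = k})"
  proof (rule measure_eqI_countable[of _ UNIV])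
    fix k :: 'b
    show "emeasure (distr M (count_space UNIV) X) {k} =
        emeasure (density (count_space UNIV) (\<lambda>k. emeasure M {w \<in> space M. X w = k})) {k}"
      by (simp add: emeasure_distr emeasure_density vimage_def Int_def conj_commute)
  qed auto
  have "(\<integral>\<^sup>+w. f (X w) \<partial>M) = (\<integral>\<^sup>+k. f k \<partial>distr M (count_space UNIV) X)"
    by (simp add: nn_integral_distr)
  then show ?thesis
    unfolding eq by (simp add: nn_integral_density mult.commute)
qed

text \<open>The Markov property only constrains the kernel after histories of positive probability; where
  \<open>\<mu> x = 0\<close>, both sides vanish.\<close>

lemma markov_chain_joint:
  assumes "markov_chain M \<mu> K Z"
  shows "emeasure M {w \<in> space M. (Z 0 w, Z 1 w) = (x, y)} =
    ennreal (\<mu> x) * ennreal (K x y)"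
proof -
  interpret prob_space M using assms by (simp add: markov_chain_def)
  have [measurable]: "Z n \<in> measurable M (count_space UNIV)" for n
    using assms by (simp add: markov_chain_def)
  have \<mu>: "\<P>(w in M. Z 0 w = x) = \<mu> x"
    using assms by (simp add: markov_chain_def)
  show ?thesis
  proof (cases "\<mu> x = 0")
    case True
    have "\<P>(w in M. (Z 0 w, Z 1 w) = (x, y)) \<le> \<P>(w in M. Z 0 w = x)"
      by (intro finite_measure_mono) auto
    then show ?thesis
      using True \<mu> by (simp add: emeasure_eq_measure measure_le_0_iff)
  next
    case False
    then have pos: "0 < \<mu> x" using \<mu> measure_nonneg by (metis less_eq_real_def)
    \<comment> \<open>The history up to time 0 is the single event \<open>Z 0 = x\<close>.\<close>
    have "\<P>(w in M. Z (Suc 0) w = y \<bar> \<forall>i\<le>0. Z i w = (\<lambda>_. x) i) = K ((\<lambda>_. x) (0::nat)) y"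
      using assms pos \<mu> unfolding markov_chain_def
      by (elim conjE allE[of _ "0::nat"] allE[of _ "\<lambda>_. x"] allE[of _ y]) simp
    then have "\<P>(w in M. Z 1 w = y \<and> Z 0 w = x) = \<mu> x * K x y"
      using \<mu> pos by (simp add: cond_prob_def field_simps)
    moreover from this have "0 \<le> K x y"
      using pos by (metis measure_nonneg zero_le_mult_iff not_less)
    ultimately show ?thesis
      using pos by (simp add: emeasure_eq_measure conj_commute ennreal_mult)
  qed
qed

lemma markov_chain_nn_integral_start:
  assumes "markov_chain M \<mu> K Z"
  shows "(\<integral>\<^sup>+w. f (Z 0 w) \<partial>M) = (\<Sum>k. f k * ennreal (\<mu> k))"
proof -
  interpret prob_space M using assms by (simp add: markov_chain_def)
  have "emeasure M {w \<in> space M. Z 0 w = k} = ennreal (\<mu> k)" for k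
    using assms by (simp add: markov_chain_def emeasure_eq_measure)
  then show ?thesis
    using assms by (subst nn_integral_countable_valued)
      (auto simp: markov_chain_def nn_integral_count_space_nat)
qed

lemma markov_chain_mean_step:
  assumes "markov_chain M \<mu> K Z"
  shows "(\<integral>\<^sup>+w. of_nat (Z 1 w) \<partial>M) = (\<Sum>x. ennreal (\<mu> x) * (\<Sum>y. of_nat y * ennreal (K x y)))"
proof -
  have [measurable]: "Z n \<in> measurable M (count_space UNIV)" for n
    using assms by (simp add: markov_chain_def)
  have pair: "(\<lambda>w. (Z 0 w, Z 1 w)) \<in> measurable M (count_space UNIV)"
    by measurable
  have "(\<integral>\<^sup>+w. of_nat (Z 1 w) \<partial>M) =
      (\<integral>\<^sup>+p. of_nat (snd p) * emeasure M {w \<in> space M. (Z 0 w, Z 1 w) = p} \<partial>count_space UNIV)"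
    using nn_integral_countable_valued[OF pair, of "\<lambda>p. of_nat (snd p)"] by simp
  also have "\<dots> = (\<Sum>x. \<Sum>y. of_nat y * (ennreal (\<mu> x) * ennreal (K x y)))"
    unfolding nn_integral_fst_count_space[symmetric]
    by (simp only: markov_chain_joint[OF assms] nn_integral_count_space_nat snd_conv)
  also have "\<dots> = (\<Sum>x. ennreal (\<mu> x) * (\<Sum>y. of_nat y * ennreal (K x y)))"
    by (simp add: mult.left_commute[of "of_nat _"])
  finally show ?thesis .
qed

section \<open>Finiteness of the limiting log-likelihood\<close>

theorem proposition4p8:
  fixes \<Theta> :: "(real ^ 'd) set"
    and \<nu> :: "real ^ 'd \<Rightarrow> real measure"
    and \<theta>star :: "real ^ 'd"
    and M :: "'a measure"
    and Z :: "nat \<Rightarrow> 'a \<Rightarrow> nat"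
  assumes "compact \<Theta>"
    and "\<And>\<theta>. \<theta> \<in> \<Theta> \<Longrightarrow> prob_space (\<nu> \<theta>)"
    and "\<And>\<theta>. \<theta> \<in> \<Theta> \<Longrightarrow> sets (\<nu> \<theta>) = sets (restrict_space borel {0<..<1})"
    and "\<theta>star \<in> interior \<Theta>"
    and "\<And>\<theta>. \<theta> \<in> \<Theta> \<Longrightarrow> integrable (env \<nu> \<theta>) (\<lambda>\<omega>. ln (rho \<omega> 0))"
    and "\<And>\<theta>. \<theta> \<in> \<Theta> \<Longrightarrow> (\<integral>\<omega>. ln (rho \<omega> 0) \<partial>env \<nu> \<theta>) < 0"
    and "(\<integral>\<^sup>+\<omega>. ennreal (rho \<omega> 0) \<partial>env \<nu> \<theta>star) < 1"
    and "markov_chain M (inv_prob \<nu> \<theta>star) (Q \<nu> \<theta>star) Z"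
  shows "\<forall>\<theta>\<in>\<Theta>. \<bar>ell \<nu> M Z \<theta>\<bar> \<noteq> \<infinity>"
proof
  fix \<theta> assume \<theta>: "\<theta> \<in> \<Theta>"
  have "\<theta>star \<in> \<Theta>" using assms(4) interior_subset by blast
  then interpret star: unit_interval_law \<nu> \<theta>star
    using assms(2,3) by (simp add: unit_interval_law_def unit_interval_law_axioms_def)
  interpret law: unit_interval_law \<nu> \<theta>
    using assms(2,3)[OF \<theta>] by (simp add: unit_interval_law_def unit_interval_law_axioms_def)
  note chain = assms(8)
  define r where "r = (\<integral>\<^sup>+\<omega>. ennreal (rho \<omega> 0) \<partial>env \<nu> \<theta>star)"
  have r: "r < 1" using assms(7) by (simp add: r_def)
  interpret M: prob_space M using chain by (simp add: markov_chain_def)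
  have [measurable]: "Z n \<in> measurable M (count_space UNIV)" for n
    using chain by (simp add: markov_chain_def)

  have EZ0: "(\<integral>\<^sup>+w. of_nat (Z 0 w) \<partial>M) < \<top>"
    unfolding markov_chain_nn_integral_start[OF chain]
    using star.inv_prob_mean_le geometric_suminf_ennreal_less_top[OF r]
    by (simp add: r_def)
  have "(\<integral>\<^sup>+w. of_nat (Z 1 w) \<partial>M) =
      (\<Sum>x. ennreal (inv_prob \<nu> \<theta>star x) * (of_nat (x + 1) * r))"
    unfolding markov_chain_mean_step[OF chain] star.transition_mean
    by (simp add: r_def star.nn_integral_rho)
  also have "\<dots> = (\<integral>\<^sup>+w. of_nat (Z 0 w + 1) * r \<partial>M)"
    unfolding markov_chain_nn_integral_start[OF chain, of "\<lambda>k. of_nat (k + 1) * r"]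
    by (simp only: mult.commute)
  also have "\<dots> = ((\<integral>\<^sup>+w. of_nat (Z 0 w) \<partial>M) + 1) * r"
    by (simp add: nn_integral_multc nn_integral_add M.emeasure_space_1 add.commute)
  also have "\<dots> < \<top>"
    using EZ0 r by (auto simp: ennreal_mult_less_top intro: less_trans)
  finally have EZ1: "(\<integral>\<^sup>+w. of_nat (Z 1 w) \<partial>M) < \<top>" .

  define C where "C = - ln (\<integral>a. a * (1 - a) \<partial>\<nu> \<theta>)"
  have "(\<integral>\<^sup>+w. ennreal (- phi \<nu> \<theta> (Z 0 w) (Z 1 w)) \<partial>M) \<le>
      (\<integral>\<^sup>+w. ennreal C * (of_nat (Z 0 w) + 1 + of_nat (Z 1 w)) \<partial>M)"
  proof (rule nn_integral_mono)
    fix w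
    have "ennreal (- phi \<nu> \<theta> (Z 0 w) (Z 1 w)) \<le> ennreal (C * real (Z 0 w + 1 + Z 1 w))"
      using law.phi_bounds(3) by (simp add: C_def ennreal_leI del: of_nat_add)
    also have "\<dots> = ennreal C * of_nat (Z 0 w + 1 + Z 1 w)"
      by (simp add: ennreal_mult'' ennreal_of_nat_eq_real_of_nat del: of_nat_add)
    finally show "ennreal (- phi \<nu> \<theta> (Z 0 w) (Z 1 w)) \<le>
        ennreal C * (of_nat (Z 0 w) + 1 + of_nat (Z 1 w))"
      by (simp add: ac_simps)
  qed
  also have "\<dots> = ennreal C *
      ((\<integral>\<^sup>+w. of_nat (Z 0 w) \<partial>M) + 1 + (\<integral>\<^sup>+w. of_nat (Z 1 w) \<partial>M))"
    by (simp add: nn_integral_cmult nn_integral_add M.emeasure_space_1)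
  also have "\<dots> < \<top>"
    using EZ0 EZ1 by (simp add: ennreal_mult_less_top)
  finally have neg: "(\<integral>\<^sup>+w. ennreal (- phi \<nu> \<theta> (Z 0 w) (Z 1 w)) \<partial>M) < \<top>" .
  have "(\<integral>\<^sup>+w. ennreal (phi \<nu> \<theta> (Z 0 w) (Z 1 w)) \<partial>M) = 0"
    using law.phi_bounds(2) by (simp add: ennreal_neg)
  moreover obtain b where "0 \<le> b"
      "(\<integral>\<^sup>+w. ennreal (- phi \<nu> \<theta> (Z 0 w) (Z 1 w)) \<partial>M) = ennreal b"
    using neg by (metis ennreal_cases less_irrefl)
  ultimately show "\<bar>ell \<nu> M Z \<theta>\<bar> \<noteq> \<infinity>"
    unfolding ell_def ext_expectation_def by (simp add: zero_ennreal.rep_eq)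
qed

end
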